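(* Let $\sigma\colon\mathbf{Sq}_\bot\to\mathbf{Sq}_\bot$ be a deflation, and let $m\ge0$ be a real number. Then there are $\mathbf c\in[0,1]^2$ and $r\in[0,m]$ such that $$\mathrm R(\sigma(\mathbf c,r))-r\ \ge\ \frac{m}{4m+1}.$$
   Context: On $\mathbb R^2$, $d_\infty((x,y),(x',y'))=\max\{|x-x'|,|y-y'|\}$. $\mathbf{Sq}=[0,1]^2\times[0,\infty)$ is ordered by $(\mathbf c,r)\sqsubseteq(\mathbf c',r')\iff d_\infty(\mathbf c,\mathbf c')\le r-r'$, and $\mathbf{Sq}_\bot=\mathbf{Sq}\cup\{\bot\}$ with $\bot$ a new least element; $\mathbf{Sq}_\bot$ is a pointed dcpo (every directed subset has a supremum, where a subset is directed if each of its finite subsets, including the empty one, has an upper bound in it). $\mathrm R(\mathbf c,r)=r$ for $(\mathbf c,r)\in\mathbf{Sq}$ and $\mathrm R(\bot)=\infty$, with $\infty-r=\infty$. A map between dcpos is Scott-continuous if it is monotone and preserves directed suprema. A deflation on a pointed dcpo $D$ is a Scott-continuous map $\sigma\colon D\to D$ with finite image such that $\sigma(x)\le x$ for every $x\in D$. *)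

theory Defs
  imports "HOL-Analysis.Analysis" "HOL-Library.Option_ord" "HOL-Library.Lub_Glb"
begin

definition directed :: "'a::order set \<Rightarrow> bool" where
  "directed A \<longleftrightarrow> (\<forall>F. finite F \<and> F \<subseteq> A \<longrightarrow> (\<exists>u\<in>A. \<forall>x\<in>F. x \<le> u))"

definition scott_continuous :: "('a::order \<Rightarrow> 'b::order) \<Rightarrow> bool" where
  "scott_continuous f \<longleftrightarrow> mono f \<and>
     (\<forall>A s. directed A \<and> isLub UNIV A s \<longrightarrow> isLub UNIV (f ` A) (f s))"

definition deflation :: "('a::order_bot \<Rightarrow> 'a) \<Rightarrow> bool" where
  "deflation \<sigma> \<longleftrightarrow> scott_continuous \<sigma> \<and> finite (range \<sigma>) \<and> (\<forall>x. \<sigma> x \<le> x)"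

definition d_inf :: "real \<times> real \<Rightarrow> real \<times> real \<Rightarrow> real" where
  "d_inf p q = max \<bar>fst p - fst q\<bar> \<bar>snd p - snd q\<bar>"

lemma d_inf_commute: "d_inf p q = d_inf q p"
  by (simp add: d_inf_def abs_minus_commute)

lemma d_inf_triangle: "d_inf p q \<le> d_inf w p + d_inf w q"
proof -
  have "\<bar>fst p - fst q\<bar> \<le> \<bar>fst w - fst p\<bar> + \<bar>fst w - fst q\<bar>"
    "\<bar>snd p - snd q\<bar> \<le> \<bar>snd w - snd p\<bar> + \<bar>snd w - snd q\<bar>" by linarith+
  then show ?thesis unfolding d_inf_def by (meson add_mono max.boundedI max.cobounded1 max.cobounded2 order_trans)
qed

text \<open>The abstraction map \<open>Sq\<close> is the pairing \<open>(c, r)\<close>; like any abstraction map it is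
  unspecified outside the representing set.\<close>

typedef sq = "({0..1} \<times> {0..1}) \<times> {0..} :: ((real \<times> real) \<times> real) set"
  morphisms rep_sq Sq
  by (rule exI[of _ "((0, 0), 0)"]) simp

definition center :: "sq \<Rightarrow> real \<times> real" where "center x = fst (rep_sq x)"

definition radius :: "sq \<Rightarrow> real" where "radius x = snd (rep_sq x)"

lemma center_Sq: "c \<in> {0..1} \<times> {0..1} \<Longrightarrow> 0 \<le> r \<Longrightarrow> center (Sq (c, r)) = c"
  by (cases c) (simp add: center_def Sq_inverse)

lemma radius_Sq: "c \<in> {0..1} \<times> {0..1} \<Longrightarrow> 0 \<le> r \<Longrightarrow> radius (Sq (c, r)) = r"
  by (cases c) (simp add: radius_def Sq_inverse)

lemma center_mem: "center x \<in> {0..1} \<times> {0..1}"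
  using rep_sq[of x] by (auto simp: center_def)

lemma radius_nonneg: "0 \<le> radius x"
  using rep_sq[of x] by (auto simp: radius_def)

lemma sq_eqI: "center x = center y \<Longrightarrow> radius x = radius y \<Longrightarrow> x = y"
  by (metis center_def radius_def prod.expand rep_sq_inject)

instantiation sq :: order
begin

definition less_eq_sq :: "sq \<Rightarrow> sq \<Rightarrow> bool" where
  "x \<le> y \<longleftrightarrow> d_inf (center x) (center y) \<le> radius x - radius y"

definition less_sq :: "sq \<Rightarrow> sq \<Rightarrow> bool" where
  "x < y \<longleftrightarrow> x \<le> y \<and> \<not> y \<le> (x::sq)"

instance
proof
  fix x y z :: sq
  show "x < y \<longleftrightarrow> x \<le> y \<and> \<not> y \<le> x" by (rule less_sq_def)
  show "x \<le> x" by (simp add: less_eq_sq_def d_inf_def)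
  show "x \<le> z" if "x \<le> y" "y \<le> z"
  proof -
    have "d_inf (center x) (center z) \<le> d_inf (center x) (center y) + d_inf (center y) (center z)"
      using d_inf_triangle[of "center x" "center z" "center y"]
      unfolding d_inf_commute[of "center y" "center x"] .
    with that show ?thesis unfolding less_eq_sq_def by linarith
  qed
  show "x = y" if "x \<le> y" "y \<le> x"
  proof -
    have d: "\<bar>fst (center x) - fst (center y)\<bar> \<le> radius x - radius y"
      "\<bar>snd (center x) - snd (center y)\<bar> \<le> radius x - radius y"
      "\<bar>fst (center y) - fst (center x)\<bar> \<le> radius y - radius x"
      using that unfolding less_eq_sq_def d_inf_def max.bounded_iff by blast+
    have r: "radius x = radius y" using d by linarith
    with d(1,2) show ?thesis by (intro sq_eqI prod_eqI) simp_all
  qed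
qed

end

text \<open>The pointed dcpo \<open>Sq\<^sub>\<bottom>\<close> is the type \<open>sq option\<close> with the order of
  \<^theory>\<open>HOL-Library.Option_ord\<close>, in which \<open>None\<close> is a new least element.\<close>

lemma sq_option_directed_complete:
  fixes A :: "sq option set"
  assumes A: "directed A"
  shows "\<exists>s. isLub UNIV A s"
proof (cases "A \<subseteq> {None}")
  case True
  then have "isLub UNIV A None"
    by (auto simp: isLub_def isUb_def leastP_def setle_def setge_def)
  then show ?thesis ..
next
  case False
  define B where "B = {x. Some x \<in> A}"
  have Bne: "B \<noteq> {}"
  proof -
    obtain a where "a \<in> A" "a \<noteq> None" using False by blast
    then show ?thesis by (cases a) (auto simp: B_def)
  qed
  have dirB: "\<exists>z\<in>B. x \<le> z \<and> y \<le> z" if "x \<in> B" "y \<in> B" for x y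
  proof -
    have "\<exists>u\<in>A. \<forall>w\<in>{Some x, Some y}. w \<le> u"
      using A[unfolded directed_def, rule_format, of "{Some x, Some y}"] that by (simp add: B_def)
    then obtain u where u: "u \<in> A" "Some x \<le> u" "Some y \<le> u" by auto
    then show ?thesis by (cases u) (auto simp: B_def)
  qed
  define \<rho> where "\<rho> = Inf (radius ` B)"
  have bdd: "bdd_below (radius ` B)" using radius_nonneg by (auto intro!: bdd_belowI[of _ 0])
  have \<rho>_le: "\<rho> \<le> radius x" if "x \<in> B" for x
    unfolding \<rho>_def using that bdd by (auto intro: cInf_lower)
  have \<rho>_greatest: "t \<le> \<rho>" if "\<And>x. x \<in> B \<Longrightarrow> t \<le> radius x" for t
    unfolding \<rho>_def using that Bne by (auto intro!: cInf_greatest)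
  have \<rho>0: "0 \<le> \<rho>" using \<rho>_greatest radius_nonneg by blast
  have coord: "\<exists>l. l \<in> {0..1} \<and> (\<forall>x\<in>B. \<bar>\<pi> x - l\<bar> \<le> radius x - \<rho>)"
    if \<pi>01: "\<And>x. \<pi> x \<in> {0..1::real}"
      and \<pi>: "\<And>x y. x \<le> y \<Longrightarrow> \<bar>\<pi> x - \<pi> y\<bar> \<le> radius x - radius y" for \<pi> :: "sq \<Rightarrow> real"
  proof -
    have cross: "\<pi> x - (radius x - \<rho>) \<le> \<pi> y + (radius y - \<rho>)" if xy: "x \<in> B" "y \<in> B" for x y
    proof -
      obtain z where z: "z \<in> B" "x \<le> z" "y \<le> z" using dirB[OF xy] by blast
      show ?thesis using \<pi>[OF z(2)] \<pi>[OF z(3)] \<rho>_le[OF z(1)] by linarith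
    qed
    define l where "l = Sup ((\<lambda>x. \<pi> x - (radius x - \<rho>)) ` B)"
    obtain b where b: "b \<in> B" using Bne by blast
    have bdd': "bdd_above ((\<lambda>x. \<pi> x - (radius x - \<rho>)) ` B)"
      using cross[OF _ b] unfolding bdd_above_def by blast
    have l1: "\<pi> x - (radius x - \<rho>) \<le> l" if "x \<in> B" for x
      unfolding l_def using that bdd' by (auto intro: cSup_upper)
    have l2: "l \<le> \<pi> x + (radius x - \<rho>)" if "x \<in> B" for x
      unfolding l_def using that Bne cross by (auto intro!: cSup_least)
    have "l - 1 + \<rho> \<le> radius x" if "x \<in> B" for x using l2[OF that] \<pi>01[of x] by auto
    from \<rho>_greatest[OF this] have "l \<le> 1" by simp
    moreover have "\<rho> - l \<le> radius x" if "x \<in> B" for x using l1[OF that] \<pi>01[of x] by auto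
    from \<rho>_greatest[OF this] have "0 \<le> l" by simp
    moreover have "\<bar>\<pi> x - l\<bar> \<le> radius x - \<rho>" if "x \<in> B" for x
      using l1[OF that] l2[OF that] by linarith
    ultimately show ?thesis by (intro exI[of _ l]) simp
  qed
  have fst01: "fst (center x) \<in> {0..1}" for x
    using center_mem[of x] unfolding mem_Times_iff by blast
  have fst_mono: "\<bar>fst (center x) - fst (center y)\<bar> \<le> radius x - radius y" if "x \<le> y" for x y
    using that unfolding less_eq_sq_def d_inf_def by simp
  obtain p where p: "p \<in> {0..1}" "\<And>x. x \<in> B \<Longrightarrow> \<bar>fst (center x) - p\<bar> \<le> radius x - \<rho>"
    using coord[of "\<lambda>x. fst (center x)", OF fst01 fst_mono] by blast
  have snd01: "snd (center x) \<in> {0..1}" for x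
    using center_mem[of x] unfolding mem_Times_iff by blast
  have snd_mono: "\<bar>snd (center x) - snd (center y)\<bar> \<le> radius x - radius y" if "x \<le> y" for x y
    using that unfolding less_eq_sq_def d_inf_def by simp
  obtain q where q: "q \<in> {0..1}" "\<And>x. x \<in> B \<Longrightarrow> \<bar>snd (center x) - q\<bar> \<le> radius x - \<rho>"
    using coord[of "\<lambda>x. snd (center x)", OF snd01 snd_mono] by blast
  define s where "s = Sq ((p, q), \<rho>)"
  have s: "center s = (p, q)" "radius s = \<rho>"
    using p q \<rho>0 by (auto simp: s_def center_Sq radius_Sq)
  have ub: "x \<le> s" if "x \<in> B" for x
    using p(2)[OF that] q(2)[OF that] by (simp add: less_eq_sq_def d_inf_def s)
  have least: "s \<le> t" if t: "\<And>x. x \<in> B \<Longrightarrow> x \<le> t" for t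
  proof -
    have "(radius t + \<rho> + d_inf (center s) (center t)) / 2 \<le> radius x" if "x \<in> B" for x
    proof -
      have "d_inf (center x) (center t) \<le> radius x - radius t"
        "d_inf (center x) (center s) \<le> radius x - \<rho>"
        using t[OF that] ub[OF that] by (simp_all add: less_eq_sq_def s)
      with d_inf_triangle[of "center s" "center t" "center x"] show ?thesis by argo
    qed
    from \<rho>_greatest[OF this] have "(radius t + \<rho> + d_inf (center s) (center t)) / 2 \<le> \<rho>" .
    then show ?thesis unfolding less_eq_sq_def s(2) by argo
  qed
  have "a \<le> Some s" if "a \<in> A" for a
    using that ub by (cases a) (auto simp: B_def)
  moreover have "Some s \<le> u" if u: "\<And>a. a \<in> A \<Longrightarrow> a \<le> u" for u
  proof -
    obtain b where "Some b \<in> A" using Bne by (auto simp: B_def)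
    from u[OF this] obtain t where t: "u = Some t" by (cases u) simp_all
    have "x \<le> t" if "x \<in> B" for x using u[of "Some x"] that t by (simp add: B_def)
    from least[OF this] t show ?thesis by simp
  qed
  ultimately have "isLub UNIV A (Some s)"
    by (auto simp: isLub_def isUb_def leastP_def setle_def setge_def)
  then show ?thesis ..
qed

fun R :: "sq option \<Rightarrow> ereal" where
  "R (Some x) = ereal (radius x)"
| "R None = \<infinity>"

end

theory Submission
  imports Defs
begin

text \<open>Write \<open>\<sigma>(c, r) = (f(c, r), \<rho>(c, r))\<close>, put \<open>e = m / (4 m + 1)\<close> and suppose that
  \<open>\<rho>(c, r) - r < e\<close> for all \<open>c\<close> in the unit square and \<open>0 \<le> r \<le> m\<close>. Then \<open>\<sigma>\<close> moves every such
  centre and radius by less than \<open>e\<close>. The contradiction is that a monotone map with finite image cannot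
  be arbitrarily close to the identity, because the order cone \<open>C = {(x, y, t). \<bar>x\<bar> \<le> t \<and> \<bar>y\<bar> \<le> t}\<close>, with
  \<open>t = - r\<close>, is not simplicial.

  As the image is finite, the derivative of \<open>\<sigma>\<close> is carried by the surfaces across which \<open>\<sigma>\<close> jumps. By
  monotonicity a jump \<open>J\<close> lies in \<open>C\<close> and the conormal \<open>\<nu>\<close> of the surface lies in the dual cone, so the
  derivative is a positive combination of rank-one operators \<open>J \<otimes> \<nu>\<close>. The reflection
  \<open>M = diag(-1, -1, 1)\<close> maps \<open>C\<close> into itself, hence \<open>\<nu>(M J) \<ge> 0\<close>; that is,
  \<open>\<partial>\<^sub>x f\<^sub>x + \<partial>\<^sub>y f\<^sub>y \<le> \<partial>\<^sub>r \<rho>\<close> in the sense of measures. The identity violates this, as \<open>1 + 1 > 1\<close>.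
  Integrated over \<open>[0, 1]\<^sup>2 \<times> [0, m]\<close>, the left side is at least \<open>2 m (1 - 2 e)\<close>, since each
  coordinate of \<open>f\<close> rises by at least \<open>1 - 2 e\<close> across the square, and the right side is less than
  \<open>m + e\<close>. But \<open>e\<close> is the solution of \<open>2 m (1 - 2 e) = m + e\<close>.

  Finite differences with a small step \<open>h = m / K\<close>, in the radius as well as in the centre, replace the
  derivatives. The left side becomes half of the integral of \<open>flux\<close>, which is bounded below in
  \<open>flux_integral\<close> by letting translated squares cancel. For the upper bound, consider the
  chain of values that \<open>\<sigma>\<close> takes over a fixed centre. If this chain is the same at the four corners of a cell of
  side \<open>h\<close>, then only the heights of the jumps differ, by at most \<open>h\<close>, and summation by parts along
  the chain gives exactly the required bound (\<open>flux_le_if_columns_agree\<close>). Over the remaining cells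
  there is only a bound that is too large by a constant factor (\<open>flux_le\<close>): monotonicity alone cannot give the
  required one, which the identity violates on every cell. The finite image now ensures that the chain takes finitely
  many forms, each on a Borel set of centres, and a small translation changes such a set by
  little (\<open>irregular_small\<close>). So the area of the remaining cells tends to 0 with \<open>h\<close>, and
  \<open>flux_inequality\<close> follows in the limit.\<close>

section \<open>Summation by parts along a chain\<close>

text \<open>The elements of \<open>S\<close> are the radii along a chain and \<open>\<alpha>\<close>, \<open>\<beta>\<close> are the sum and the difference
  of the coordinates of the centres. Summation by parts turns the left side into a sum of increments of \<open>\<alpha>\<close>
  and \<open>\<beta>\<close> times partial sums of the weights. Since \<open>\<bar>x + y\<bar> + \<bar>x - y\<bar> = 2 max \<bar>x\<bar> \<bar>y\<bar>\<close>, comparability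
  in the chain bounds the two increments together by twice the step in the radius, so the two directions
  share one budget. The boundary terms at \<open>Max S\<close> make the induction on the largest element go
  through; they vanish when the weights sum to 0.\<close>
lemma chain_summation_by_parts:
  fixes S :: "real set" and \<alpha> \<beta> w w' :: "real \<Rightarrow> real"
  assumes "finite S" and "S \<noteq> {}"
    and "\<And>s t. s \<in> S \<Longrightarrow> t \<in> S \<Longrightarrow> \<bar>\<alpha> s - \<alpha> t\<bar> + \<bar>\<beta> s - \<beta> t\<bar> \<le> 2 * \<bar>s - t\<bar>"
    and "\<And>t. \<bar>\<Sum>s\<in>{s \<in> S. s \<le> t}. w s\<bar> \<le> 1"
    and "\<And>t. \<bar>\<Sum>s\<in>{s \<in> S. s \<le> t}. w' s\<bar> \<le> 1"
  shows "(\<Sum>s\<in>S. \<alpha> s * w s + \<beta> s * w' s)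
    \<le> 2 * (Max S - Min S) + \<alpha> (Max S) * sum w S + \<beta> (Max S) * sum w' S"
  using assms
proof (induction S rule: finite_linorder_max_induct)
  case empty
  then show ?case by simp
next
  case (insert b A)
  show ?case
  proof (cases "A = {}")
    case True
    then show ?thesis by simp
  next
    case False
    define p where "p = Max A"
    have p: "p \<in> A" "p < b" "\<And>a. a \<in> A \<Longrightarrow> a \<le> p"
      using insert.hyps False by (auto simp: p_def)
    have seg: "{s \<in> A. s \<le> t} = {s \<in> insert b A. s \<le> min t p}" for t
      using p by auto
    have all: "A = {s \<in> insert b A. s \<le> p}" using p by auto
    have W: "\<bar>sum w A\<bar> \<le> 1" "\<bar>sum w' A\<bar> \<le> 1"
      using insert.prems(3,4)[of p] all by simp_all
    have IH: "(\<Sum>s\<in>A. \<alpha> s * w s + \<beta> s * w' s) \<le> 2 * (p - Min A) + \<alpha> p * sum w A + \<beta> p * sum w' A"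
      unfolding p_def
    proof (rule insert.IH[OF False])
      show "\<bar>\<alpha> s - \<alpha> t\<bar> + \<bar>\<beta> s - \<beta> t\<bar> \<le> 2 * \<bar>s - t\<bar>" if "s \<in> A" "t \<in> A" for s t
        using insert.prems(2)[of s t] that by simp
    qed (unfold seg, rule insert.prems(3), rule insert.prems(4))
    have step: "(\<alpha> p - \<alpha> b) * sum w A + (\<beta> p - \<beta> b) * sum w' A \<le> 2 * (b - p)"
    proof -
      have "(\<alpha> p - \<alpha> b) * sum w A \<le> \<bar>\<alpha> p - \<alpha> b\<bar> * \<bar>sum w A\<bar>"
        "(\<beta> p - \<beta> b) * sum w' A \<le> \<bar>\<beta> p - \<beta> b\<bar> * \<bar>sum w' A\<bar>"
        unfolding abs_mult[symmetric] by simp_all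
      moreover have "\<bar>\<alpha> p - \<alpha> b\<bar> * \<bar>sum w A\<bar> \<le> \<bar>\<alpha> p - \<alpha> b\<bar>"
        "\<bar>\<beta> p - \<beta> b\<bar> * \<bar>sum w' A\<bar> \<le> \<bar>\<beta> p - \<beta> b\<bar>"
        using W by (simp_all add: mult_left_le)
      ultimately show ?thesis using insert.prems(2)[of p b] p by simp
    qed
    have nb: "b \<notin> A" using insert.hyps by auto
    have "Max (insert b A) = b" using insert.hyps p by (intro Max_eqI) auto
    moreover have "Min (insert b A) = Min A"
      using insert.hyps False p(1,2) by (simp add: Min_insert min_def) (meson Min_le le_less_trans less_le_not_le)
    ultimately show ?thesis
      using IH step insert.hyps(1) nb by (simp add: algebra_simps)
  qed
qed

text \<open>The weights here are differences of counting functions: as many indices run through the one column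
  as through the other, and the counting condition says that the jumps of the two columns are at most one
  index apart.\<close>
lemma chain_variation:
  fixes \<rho>1 \<rho>2 \<rho>3 \<rho>4 :: "nat \<Rightarrow> real" and \<alpha> \<beta> :: "real \<Rightarrow> real"
  assumes S: "finite S" "S \<noteq> {}"
    and lip: "\<And>s t. s \<in> S \<Longrightarrow> t \<in> S \<Longrightarrow> \<bar>\<alpha> s - \<alpha> t\<bar> + \<bar>\<beta> s - \<beta> t\<bar> \<le> 2 * \<bar>s - t\<bar>"
    and mem: "\<And>k. k < K \<Longrightarrow> \<rho>1 k \<in> S \<and> \<rho>2 k \<in> S \<and> \<rho>3 k \<in> S \<and> \<rho>4 k \<in> S"
    and count12: "\<And>t. \<bar>real (card {k. k < K \<and> \<rho>1 k \<le> t}) - real (card {k. k < K \<and> \<rho>2 k \<le> t})\<bar> \<le> 1"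
    and count34: "\<And>t. \<bar>real (card {k. k < K \<and> \<rho>3 k \<le> t}) - real (card {k. k < K \<and> \<rho>4 k \<le> t})\<bar> \<le> 1"
  shows "(\<Sum>k<K. \<alpha> (\<rho>1 k) - \<alpha> (\<rho>2 k) + (\<beta> (\<rho>3 k) - \<beta> (\<rho>4 k))) \<le> 2 * (Max S - Min S)"
proof -
  define w where "w p q s = (\<Sum>k<K. of_bool (p k = s) - of_bool (q k = s) :: real)" for p q :: "nat \<Rightarrow> real" and s
  have partial: "(\<Sum>s\<in>{s \<in> S. s \<le> t}. w p q s) = real (card {k. k < K \<and> p k \<le> t}) - real (card {k. k < K \<and> q k \<le> t})"
    if "\<And>k. k < K \<Longrightarrow> p k \<in> S \<and> q k \<in> S" for p q t
  proof -
    have *: "(\<Sum>s\<in>{s \<in> S. s \<le> t}. of_bool (x = s) :: real) = of_bool (x \<le> t)" if "x \<in> S" for x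
      using that S(1) by (simp add: of_bool_def)
    have "(\<Sum>s\<in>{s \<in> S. s \<le> t}. w p q s) = (\<Sum>k<K. \<Sum>s\<in>{s \<in> S. s \<le> t}. of_bool (p k = s) - of_bool (q k = s))"
      unfolding w_def by (rule sum.swap)
    also have "\<dots> = (\<Sum>k<K. of_bool (p k \<le> t) - of_bool (q k \<le> t))"
      using that by (intro sum.cong) (simp_all add: sum_subtractf *)
    also have "\<dots> = real (card {k. k < K \<and> p k \<le> t}) - real (card {k. k < K \<and> q k \<le> t})"
      by (simp add: sum_subtractf lessThan_def Int_def Collect_conj_eq[symmetric])
    finally show ?thesis .
  qed
  have weighted: "(\<Sum>s\<in>S. f s * w p q s) = (\<Sum>k<K. f (p k) - f (q k))"
    if "\<And>k. k < K \<Longrightarrow> p k \<in> S \<and> q k \<in> S" for p q and f :: "real \<Rightarrow> real"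
  proof -
    have *: "(\<Sum>s\<in>S. f s * of_bool (x = s) :: real) = f x" if "x \<in> S" for x
      using that S(1) by (simp add: of_bool_def if_distrib[of "(*) _"] cong: if_cong)
    have "(\<Sum>s\<in>S. f s * w p q s) = (\<Sum>k<K. \<Sum>s\<in>S. f s * (of_bool (p k = s) - of_bool (q k = s)))"
      unfolding w_def sum_distrib_left by (rule sum.swap)
    also have "\<dots> = (\<Sum>k<K. f (p k) - f (q k))"
      using that by (intro sum.cong) (simp_all add: right_diff_distrib sum_subtractf *)
    finally show ?thesis .
  qed
  have total: "sum (w p q) S = 0" if "\<And>k. k < K \<Longrightarrow> p k \<in> S \<and> q k \<in> S" for p q
    using weighted[OF that, where f = "\<lambda>_. 1"] by simp
  have m12: "\<And>k. k < K \<Longrightarrow> \<rho>1 k \<in> S \<and> \<rho>2 k \<in> S" and m34: "\<And>k. k < K \<Longrightarrow> \<rho>3 k \<in> S \<and> \<rho>4 k \<in> S"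
    using mem by blast+
  have "(\<Sum>s\<in>S. \<alpha> s * w \<rho>1 \<rho>2 s + \<beta> s * w \<rho>3 \<rho>4 s)
      \<le> 2 * (Max S - Min S) + \<alpha> (Max S) * sum (w \<rho>1 \<rho>2) S + \<beta> (Max S) * sum (w \<rho>3 \<rho>4) S"
    by (rule chain_summation_by_parts[OF S lip])
      (simp_all add: partial[OF m12] partial[OF m34] count12 count34)
  then show ?thesis
    by (simp add: total[OF m12] total[OF m34] sum.distrib weighted[OF m12] weighted[OF m34])
qed

section \<open>Integrals over translated squares\<close>

text \<open>After a change of variables the integrand is \<open>\<phi>\<close> on both translates of \<open>Q\<close>, so that only the
  parts which do not overlap contribute. This replaces the fundamental theorem of calculus.\<close>
lemma translation_difference_ge:
  fixes \<phi> :: "'a::euclidean_space \<Rightarrow> real" and a b :: 'a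
  assumes \<phi>[measurable]: "\<phi> \<in> borel_measurable borel" and bdd: "\<And>c. \<bar>\<phi> c\<bar> \<le> M"
    and Q[measurable]: "Q \<in> sets borel" and Qfin: "emeasure lborel Q < \<infinity>"
    and lo: "\<And>c. c \<in> (+) a ` Q \<Longrightarrow> c \<notin> (+) b ` Q \<Longrightarrow> A \<le> \<phi> c"
    and hi: "\<And>c. c \<in> (+) b ` Q \<Longrightarrow> c \<notin> (+) a ` Q \<Longrightarrow> \<phi> c \<le> B"
    and \<mu>: "measure lborel ((+) a ` Q - (+) b ` Q) = \<mu>" "measure lborel ((+) b ` Q - (+) a ` Q) = \<mu>"
  shows "(A - B) * \<mu> \<le> (LINT c|lborel. indicator Q c * (\<phi> (c + a) - \<phi> (c + b)))"
    and "integrable lborel (\<lambda>c. indicator Q c * (\<phi> (c + a) - \<phi> (c + b)))"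
proof -
  have im: "(+) v ` Q = (\<lambda>c. c - v) -` Q" for v
    by (force simp: image_iff)
  have imb[measurable]: "(+) v ` Q \<in> sets borel" for v
    unfolding im using measurable_sets[of "\<lambda>c. c - v" borel borel Q] by simp
  have tr: "emeasure lborel ((+) v ` Q) = emeasure lborel Q" for v
  proof -
    have "emeasure lborel ((+) v ` Q) = emeasure (distr lborel borel ((+) v)) ((+) v ` Q)"
      by (simp add: lborel_distr_plus)
    also have "\<dots> = emeasure lborel ((+) v -` (+) v ` Q)" by (subst emeasure_distr) auto
    also have "(+) v -` (+) v ` Q = Q" by auto
    finally show ?thesis .
  qed
  have int: "integrable lborel (\<lambda>c. indicator ((+) v ` Q) c * \<phi> c)" for v
  proof (rule Bochner_Integration.integrable_bound)
    show "integrable lborel (\<lambda>c. M * indicator ((+) v ` Q) c)" using Qfin tr by simp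
    show "AE c in lborel. norm (indicator ((+) v ` Q) c * \<phi> c) \<le> norm (M * indicator ((+) v ` Q) c)"
    proof (rule AE_I2)
      show "norm (indicator ((+) v ` Q) c * \<phi> c) \<le> norm (M * indicator ((+) v ` Q) c)" for c
        using bdd[of c] by (auto simp: indicator_def)
    qed
  qed simp
  have shift: "has_bochner_integral lborel (\<lambda>c. indicator Q c * \<phi> (c + v)) (LINT c|lborel. indicator ((+) v ` Q) c * \<phi> c)" for v
  proof -
    have "has_bochner_integral (distr lborel borel ((+) v)) (\<lambda>c. indicator ((+) v ` Q) c * \<phi> c)
        (LINT c|lborel. indicator ((+) v ` Q) c * \<phi> c)"
      unfolding lborel_distr_plus using int by (rule has_bochner_integral_integrable)
    then have "has_bochner_integral lborel (\<lambda>c. indicator ((+) v ` Q) (v + c) * \<phi> (v + c))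
        (LINT c|lborel. indicator ((+) v ` Q) c * \<phi> c)"
      by (simp add: has_bochner_integral_iff integrable_distr_eq integral_distr)
    moreover have "indicator ((+) v ` Q) (v + c) = (indicator Q c :: real)" for c
      by (auto simp: indicator_def)
    ultimately show ?thesis by (simp add: add.commute)
  qed
  have diff: "has_bochner_integral lborel (\<lambda>c. indicator Q c * (\<phi> (c + a) - \<phi> (c + b)))
     ((LINT c|lborel. indicator ((+) a ` Q) c * \<phi> c) - (LINT c|lborel. indicator ((+) b ` Q) c * \<phi> c))"
    using has_bochner_integral_diff[OF shift[of a] shift[of b]] by (simp add: right_diff_distrib)
  then show "integrable lborel (\<lambda>c. indicator Q c * (\<phi> (c + a) - \<phi> (c + b)))"
    unfolding has_bochner_integral_iff by (rule conjunct1)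
  have fin: "emeasure lborel ((+) v ` Q - (+) w ` Q) < \<infinity>" for v w
  proof -
    have "emeasure lborel ((+) v ` Q - (+) w ` Q) \<le> emeasure lborel ((+) v ` Q)"
      by (rule emeasure_mono[OF Diff_subset]) simp
    also have "\<dots> < \<infinity>" unfolding tr by (rule Qfin)
    finally show ?thesis .
  qed
  have "(A - B) * \<mu> = (LINT c|lborel. A * indicator ((+) a ` Q - (+) b ` Q) c - B * indicator ((+) b ` Q - (+) a ` Q) c)"
    using fin \<mu> by (subst Bochner_Integration.integral_diff) (auto simp: left_diff_distrib)
  also have "\<dots> \<le> (LINT c|lborel. indicator ((+) a ` Q) c * \<phi> c - indicator ((+) b ` Q) c * \<phi> c)"
  proof (rule integral_mono)
    fix c show "A * indicator ((+) a ` Q - (+) b ` Q) c - B * indicator ((+) b ` Q - (+) a ` Q) c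
       \<le> indicator ((+) a ` Q) c * \<phi> c - indicator ((+) b ` Q) c * \<phi> c"
      using lo[of c] hi[of c] by (cases "c \<in> (+) a ` Q"; cases "c \<in> (+) b ` Q") (simp_all add: indicator_def)
  next
    show "integrable lborel (\<lambda>c. indicator ((+) a ` Q) c * \<phi> c - indicator ((+) b ` Q) c * \<phi> c)"
      by (rule Bochner_Integration.integrable_diff[OF int int])
  qed (use fin in auto)
  also have "\<dots> = (LINT c|lborel. indicator ((+) a ` Q) c * \<phi> c) - (LINT c|lborel. indicator ((+) b ` Q) c * \<phi> c)"
    by (rule Bochner_Integration.integral_diff[OF int int])
  also have "\<dots> = (LINT c|lborel. indicator Q c * (\<phi> (c + a) - \<phi> (c + b)))"
    using diff by (simp add: has_bochner_integral_integral_eq)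
  finally show "(A - B) * \<mu> \<le> (LINT c|lborel. indicator Q c * (\<phi> (c + a) - \<phi> (c + b)))" .
qed

abbreviation unit_square :: "(real \<times> real) set" where "unit_square \<equiv> {0..1} \<times> {0..1}"

lemma compact_unit_square: "compact unit_square"
  by (intro compact_Times compact_Icc)

lemma unit_square_borel: "unit_square \<in> sets borel"
  using compact_unit_square by (rule borel_compact)

lemma unit_square_finite: "emeasure lborel unit_square < \<infinity>"
  using compact_unit_square by (rule emeasure_compact_finite)

lemma measure_lborel_Times:
  fixes A B :: "real set"
  assumes "A \<in> sets borel" "B \<in> sets borel"
  shows "measure lborel (A \<times> B) = measure lborel A * measure lborel B"
  unfolding measure_def lborel_prod[symmetric]
  using assms by (subst lborel.emeasure_pair_measure_Times) (auto simp: enn2real_mult)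

lemma translate_unit_square: "(+) (a, b) ` unit_square = {a..a + 1} \<times> {b..b + 1}"
proof -
  have "(+) (a, b) ` (A \<times> B) = (+) a ` A \<times> (+) b ` B" for A B :: "real set"
    by (auto simp: image_iff)
  from this[of "{0..1}" "{0..1}"] show ?thesis by (simp add: add.commute)
qed

text \<open>The differences of \<open>translate_unit_square\<close>; the form \<open>0..0 + 1\<close> is the instance of its
  right side for a zero coordinate.\<close>
lemma translates_diff:
  assumes "0 \<le> (h::real)" "h \<le> 1"
  shows "{h..h + 1} \<times> {b..b + 1} - {0..0 + 1} \<times> {b..b + 1} = {1<..h + 1} \<times> {b..b + (1::real)}"
    "{0..0 + 1} \<times> {b..b + 1} - {h..h + 1} \<times> {b..b + 1} = {0..<h} \<times> {b..b + (1::real)}"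
    "{b..b + 1} \<times> {h..h + 1} - {b..b + 1} \<times> {0..0 + 1} = {b..b + (1::real)} \<times> {1<..h + 1}"
    "{b..b + 1} \<times> {0..0 + 1} - {b..b + 1} \<times> {h..h + 1} = {b..b + (1::real)} \<times> {0..<h}"
  using assms by auto

text \<open>The domain of integration gains a strip beyond the coordinate value 1, where \<open>\<phi>\<close> is almost 1, and
  loses a strip of the same area at the coordinate value 0, where \<open>\<phi>\<close> is almost 0. Clamping keeps
  \<open>\<phi>\<close> meaningful on the strip outside the square.\<close>

lemma near_coordinate_shift_integral:
  fixes \<phi> p :: "real \<times> real \<Rightarrow> real" and a b :: "real \<times> real"
  assumes \<phi>: "\<phi> \<in> borel_measurable borel" "\<And>c. \<bar>\<phi> c\<bar> \<le> 1"
    and near: "\<And>c. \<bar>\<phi> c - max 0 (min 1 (p c))\<bar> \<le> e"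
    and gained: "(+) a ` unit_square - (+) b ` unit_square = G" "measure lborel G = h" "\<And>c. c \<in> G \<Longrightarrow> 1 \<le> p c"
    and lost: "(+) b ` unit_square - (+) a ` unit_square = N" "measure lborel N = h" "\<And>c. c \<in> N \<Longrightarrow> p c \<le> h"
    and h: "0 \<le> h"
  shows "h * (1 - h - 2 * e) \<le> (LINT c|lborel. indicator unit_square c * (\<phi> (c + a) - \<phi> (c + b)))"
    and "integrable lborel (\<lambda>c. indicator unit_square c * (\<phi> (c + a) - \<phi> (c + b)))"
proof -
  have lo: "1 - e \<le> \<phi> c" if "c \<in> (+) a ` unit_square" "c \<notin> (+) b ` unit_square" for c
  proof -
    have "c \<in> G" using that gained(1) by blast
    from gained(3)[OF this] show ?thesis using near[of c] by simp
  qed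
  have hi: "\<phi> c \<le> h + e" if "c \<in> (+) b ` unit_square" "c \<notin> (+) a ` unit_square" for c
  proof -
    have "c \<in> N" using that lost(1) by blast
    from lost(3)[OF this] show ?thesis using near[of c] h by linarith
  qed
  have \<mu>: "measure lborel ((+) a ` unit_square - (+) b ` unit_square) = h"
    "measure lborel ((+) b ` unit_square - (+) a ` unit_square) = h"
    using gained(1,2) lost(1,2) by simp_all
  note * = translation_difference_ge[OF \<phi> unit_square_borel unit_square_finite lo hi \<mu>]
  show "h * (1 - h - 2 * e) \<le> (LINT c|lborel. indicator unit_square c * (\<phi> (c + a) - \<phi> (c + b)))"
    using *(1) by (simp add: algebra_simps)
  show "integrable lborel (\<lambda>c. indicator unit_square c * (\<phi> (c + a) - \<phi> (c + b)))"
    by (rule *(2))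
qed

section \<open>Translations move a Borel set by little\<close>

text \<open>Approximate \<open>E\<close> and its complement from outside by open sets \<open>U\<close> and \<open>V\<close>. A point of the
  compact set \<open>Q - V\<close> lies in \<open>E\<close>, hence has a uniform distance from the complement of \<open>U\<close>, and similarly for
  \<open>Q - U\<close>. So if membership in \<open>E\<close> changes under a short translation, then the point or its translate lies
  in the small set \<open>(U - E) \<union> (V \<inter> E)\<close>.\<close>
lemma translation_almost_invariant:
  fixes E Q :: "'a::euclidean_space set"
  assumes E: "E \<in> sets borel" and Q: "compact Q" and e: "0 < e"
  shows "\<exists>d>0. \<forall>a. norm a < d \<longrightarrow> measure lborel {c \<in> Q. (c \<in> E) \<noteq> (c + a \<in> E)} \<le> e"
proof -
  have nE: "- E \<in> sets borel" using E by simp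
  obtain U where U: "open U" "E \<subseteq> U" "emeasure lborel (U - E) < ennreal (e/4)"
    using outer_regular_lborel[OF E, of "e/4"] e by auto
  obtain V where V: "open V" "- E \<subseteq> V" "emeasure lborel (V - - E) < ennreal (e/4)"
    using outer_regular_lborel[OF nE, of "e/4"] e by auto
  define N where "N = (U - E) \<union> (V - - E)"
  have Nb[measurable]: "N \<in> sets borel" using U V E by (auto simp: N_def)
  have "emeasure lborel N \<le> emeasure lborel (U - E) + emeasure lborel (V - - E)"
    unfolding N_def using U V E by (intro emeasure_subadditive) auto
  also have "\<dots> \<le> ennreal (e/4) + ennreal (e/4)"
    using U(3) V(3) by (intro add_mono) auto
  also have "\<dots> = ennreal (e/2)" using e by (subst ennreal_plus[symmetric]) auto
  finally have N: "emeasure lborel N \<le> ennreal (e/2)" .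
  obtain d1 where d1: "0 < d1" "\<forall>x\<in>Q - V. \<forall>y\<in>- U. d1 \<le> dist x y"
    using separate_compact_closed[OF compact_diff[OF Q V(1)], of "- U"] U V by blast
  obtain d2 where d2: "0 < d2" "\<forall>x\<in>Q - U. \<forall>y\<in>- V. d2 \<le> dist x y"
    using separate_compact_closed[OF compact_diff[OF Q U(1)], of "- V"] U V by blast
  have "measure lborel {c \<in> Q. (c \<in> E) \<noteq> (c + a \<in> E)} \<le> e" if a: "norm a < min d1 d2" for a
  proof -
    have sub: "{c \<in> Q. (c \<in> E) \<noteq> (c + a \<in> E)} \<subseteq> N \<union> ((+) a -` N)"
    proof
      fix c assume c: "c \<in> {c \<in> Q. (c \<in> E) \<noteq> (c + a \<in> E)}"
      have dd: "dist c (a + c) < d1" "dist c (a + c) < d2" using a by (simp_all add: dist_norm)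
      show "c \<in> N \<union> ((+) a -` N)"
        using c d1(2)[rule_format, of c "a + c"] d2(2)[rule_format, of c "a + c"] dd
        by (auto simp: N_def add.commute[of c a])
    qed
    have tr: "emeasure lborel ((+) a -` N) = emeasure lborel N"
    proof -
      have "emeasure lborel N = emeasure (distr lborel borel ((+) a)) N" by (simp add: lborel_distr_plus)
      also have "\<dots> = emeasure lborel ((+) a -` N)" by (subst emeasure_distr) auto
      finally show ?thesis by simp
    qed
    have ms: "(+) a -` N \<in> sets borel"
      using measurable_sets[of "(+) a" borel borel N] by simp
    have "emeasure lborel {c \<in> Q. (c \<in> E) \<noteq> (c + a \<in> E)} \<le> emeasure lborel (N \<union> ((+) a -` N))"
      using sub ms by (intro emeasure_mono) auto
    also have "\<dots> \<le> emeasure lborel N + emeasure lborel ((+) a -` N)"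
      using ms by (intro emeasure_subadditive) auto
    also have "\<dots> \<le> ennreal (e/2) + ennreal (e/2)" unfolding tr using N by (intro add_mono)
    also have "\<dots> = ennreal e" using e by (subst ennreal_plus[symmetric]) auto
    finally show ?thesis using e by (simp add: measure_def enn2real_leI)
  qed
  then show ?thesis using d1(1) d2(1) by (intro exI[of _ "min d1 d2"]) auto
qed

section \<open>Families of columns with finitely many values\<close>

text \<open>The nearest point of the unit square. Composing with it extends a map on squares to all centres of
  the plane, so that finite differences make sense up to the boundary.\<close>
definition clamp :: "real \<times> real \<Rightarrow> real \<times> real" where
  "clamp c = (max 0 (min 1 (fst c)), max 0 (min 1 (snd c)))"

lemma clamp_mem: "clamp c \<in> {0..1} \<times> {0..1}"
  by (auto simp: clamp_def)

lemma d_inf_clamp_le: "d_inf (clamp c) (clamp c') \<le> d_inf c c'"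
proof -
  have "\<bar>max 0 (min 1 a) - max 0 (min 1 b)\<bar> \<le> \<bar>a - b\<bar>" for a b :: real by linarith
  then show ?thesis unfolding d_inf_def clamp_def fst_conv snd_conv by (intro max.mono)
qed

lemma le_imp_center_close:
  assumes "u \<le> v \<or> v \<le> (u::sq)"
  shows "\<bar>fst (center u) - fst (center v)\<bar> \<le> \<bar>radius u - radius v\<bar>"
    and "\<bar>snd (center u) - snd (center v)\<bar> \<le> \<bar>radius u - radius v\<bar>"
  using assms unfolding less_eq_sq_def d_inf_def max.bounded_iff by linarith+

lemma le_imp_radius_ge: "u \<le> v \<Longrightarrow> radius v \<le> radius (u::sq)"
  unfolding less_eq_sq_def d_inf_def max.bounded_iff by linarith

text \<open>What is used of a deflation whose values over radii up to \<open>m\<close> stay close to the argument: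
  \<open>g c r\<close> stands for the value at the square with centre \<open>clamp c\<close> and radius \<open>r\<close>, \<open>L\<close> bounds the radii
  of the values, and \<open>e\<close> bounds the displacement of the centres. \<open>g_right\<close> is the part of
  Scott-continuity that provides measurability.\<close>
locale step_family =
  fixes g :: "real \<times> real \<Rightarrow> real \<Rightarrow> sq" and m L e :: real
  assumes m_pos: "0 < m"
    and g_mono: "0 \<le> s \<Longrightarrow> r \<le> m \<Longrightarrow> d_inf c c' \<le> r - s \<Longrightarrow> g c r \<le> g c' s"
    and finite_values: "finite (range (\<lambda>(c, r). g c r))"
    and g_right: "0 \<le> r \<Longrightarrow> r < m \<Longrightarrow> \<exists>\<delta>>0. r + \<delta> \<le> m \<and> g c (r + \<delta>) = g c r"
    and radius_le: "0 \<le> r \<Longrightarrow> r \<le> m \<Longrightarrow> radius (g c r) \<le> L"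
    and near: "0 \<le> r \<Longrightarrow> r \<le> m \<Longrightarrow> d_inf (center (g c r)) (clamp c) \<le> e"
begin

definition vals :: "sq set" where "vals = range (\<lambda>(c, r). g c r)"

text \<open>The top radius \<open>m\<close> is left out, so that each value is also attained at some larger, and hence
  at some rational, radius below \<open>m\<close>.\<close>
definition column :: "real \<times> real \<Rightarrow> sq set" where "column c = g c ` {0..<m}"

definition X :: "real \<times> real \<Rightarrow> real \<Rightarrow> real" where "X c r = fst (center (g c r))"

definition Y :: "real \<times> real \<Rightarrow> real \<Rightarrow> real" where "Y c r = snd (center (g c r))"

text \<open>\<open>2 h\<close> times the discrete divergence of the centre of \<open>g\<close> in the cell with corners \<open>c\<close> and
  \<open>c + (h, h)\<close>, summed over the \<open>K\<close> levels. Averaging the differences over opposite edges of the cell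
  makes the four terms regroup along the two diagonals, as
  \<open>[x + y](c + (h, h)) - [x + y](c)\<close> plus \<open>[x - y](c + (h, 0)) - [x - y](c + (0, h))\<close>; on each diagonal
  the endpoints have \<open>d_inf\<close>-distance \<open>h\<close>.\<close>
definition flux :: "nat \<Rightarrow> real \<Rightarrow> real \<times> real \<Rightarrow> real" where
  "flux K h c = (\<Sum>k<K. (X (c + (h, h)) (h * real k) - X (c + (0, h)) (h * real k)) + (X (c + (h, 0)) (h * real k) - X c (h * real k))
     + ((Y (c + (h, h)) (h * real k) - Y (c + (h, 0)) (h * real k)) + (Y (c + (0, h)) (h * real k) - Y c (h * real k))))"

lemma column_chain: "u \<in> column c \<Longrightarrow> v \<in> column c \<Longrightarrow> u \<le> v \<or> v \<le> u"
proof -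
  have *: "g c r \<le> g c s" if "0 \<le> s" "r < m" "s \<le> r" for r s
    using that by (intro g_mono) (simp_all add: d_inf_def)
  show "u \<in> column c \<Longrightarrow> v \<in> column c \<Longrightarrow> u \<le> v \<or> v \<le> u"
    unfolding column_def by (auto dest: * intro: *) (meson * linear)
qed

lemma grid_in_column:
  assumes "0 < K" "h = m / real K" "k < K"
  shows "g c (h * real k) \<in> column c"
proof -
  have "0 < h" "h * real K = m" using assms(1,2) m_pos by simp_all
  then have "0 \<le> h * k" "h * k < m"
    using assms(3) mult_strict_left_mono[of "real k" "real K" h] by simp_all
  then show ?thesis by (simp add: column_def)
qed

lemma grid_bounds:
  assumes "0 < K" "h = m / real K" "k \<le> K"
  shows "0 \<le> h * real k" "h * real k \<le> m"
proof -
  have "0 < h" "h * real K = m" using assms(1,2) m_pos by simp_all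
  then show "0 \<le> h * real k" "h * real k \<le> m"
    using assms(3) mult_left_mono[of "real k" "real K" h] by simp_all
qed

text \<open>Level \<open>k + 1\<close> over \<open>c\<close> lies below level \<open>k\<close> over any \<open>c'\<close> within distance \<open>h\<close>, so the
  second column passes a given radius at most one level earlier or later than the first.\<close>
lemma radius_count_le:
  assumes K: "0 < K" "h = m / real K" and d: "d_inf c c' \<le> h"
  shows "card {k. k < K \<and> radius (g c (h * real k)) \<le> t} \<le> Suc (card {k. k < K \<and> radius (g c' (h * real k)) \<le> t})"
proof -
  have "{k. k < K \<and> radius (g c (h * real k)) \<le> t} \<subseteq> insert 0 (Suc ` {k. k < K \<and> radius (g c' (h * real k)) \<le> t})"
  proof
    fix k assume k: "k \<in> {k. k < K \<and> radius (g c (h * real k)) \<le> t}"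
    show "k \<in> insert 0 (Suc ` {k. k < K \<and> radius (g c' (h * real k)) \<le> t})"
    proof (cases k)
      case (Suc j)
      have "g c (h * real (Suc j)) \<le> g c' (h * real j)"
        using grid_bounds[OF K, of "Suc j"] grid_bounds[OF K, of j] k Suc d
        by (intro g_mono) (auto simp: algebra_simps)
      from le_imp_radius_ge[OF this] show ?thesis using k Suc by auto
    qed simp
  qed
  then have "card {k. k < K \<and> radius (g c (h * real k)) \<le> t}
      \<le> card (insert 0 (Suc ` {k. k < K \<and> radius (g c' (h * real k)) \<le> t}))"
    by (intro card_mono) auto
  also have "\<dots> \<le> Suc (card {k. k < K \<and> radius (g c' (h * real k)) \<le> t})"
    by (simp add: card_insert_if card_image)
  finally show ?thesis .
qed

text \<open>Here the four columns run through the same chain of values, and on a chain the radius determines the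
  centre. So the flux is a sum over one chain to which \<open>chain_variation\<close> applies, and the total variation in
  the radius is at most \<open>L\<close>.\<close>
lemma flux_le_if_columns_agree:
  assumes K: "0 < K" "h = m / real K"
    and agree: "column (c + (h, 0)) = column c" "column (c + (0, h)) = column c" "column (c + (h, h)) = column c"
  shows "flux K h c \<le> 2 * L"
proof -
  have h: "0 < h" using K m_pos by simp
  define C where "C = column c"
  define \<xi> where "\<xi> s = center (inv_into C radius s)" for s
  have C_fin: "finite C"
    unfolding C_def column_def by (rule finite_subset[OF _ finite_values]) auto
  have C_ne: "C \<noteq> {}" using grid_in_column[OF K, of 0 c] K by (auto simp: C_def)
  have inj: "inj_on radius C"
  proof (rule inj_onI)
    fix u v assume uv: "u \<in> C" "v \<in> C" "radius u = radius v"
    with column_chain[of u c v] have "u \<le> v \<or> v \<le> u" by (simp add: C_def)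
    from le_imp_center_close[OF this] uv(3) show "u = v"
      by (intro sq_eqI prod_eqI) auto
  qed
  have \<xi>: "\<xi> (radius u) = center u" if "u \<in> C" for u
    using that inj by (simp add: \<xi>_def)
  define \<alpha> where "\<alpha> s = fst (\<xi> s) + snd (\<xi> s)" for s
  define \<beta> where "\<beta> s = fst (\<xi> s) - snd (\<xi> s)" for s
  have lip: "\<bar>\<alpha> s - \<alpha> t\<bar> + \<bar>\<beta> s - \<beta> t\<bar> \<le> 2 * \<bar>s - t\<bar>" if "s \<in> radius ` C" "t \<in> radius ` C" for s t
  proof -
    obtain u v where uv: "u \<in> C" "v \<in> C" "s = radius u" "t = radius v" using \<open>s \<in> _\<close> \<open>t \<in> _\<close> by blast
    then have "u \<le> v \<or> v \<le> u" using column_chain[of u c v] by (simp add: C_def)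
    note close = le_imp_center_close[OF this]
    have "\<bar>a + b\<bar> + \<bar>a - b\<bar> \<le> 2 * d" if "\<bar>a\<bar> \<le> d" "\<bar>b\<bar> \<le> d" for a b d :: real
      using that by linarith
    from this[OF close] have "\<bar>(fst (center u) - fst (center v)) + (snd (center u) - snd (center v))\<bar>
        + \<bar>(fst (center u) - fst (center v)) - (snd (center u) - snd (center v))\<bar> \<le> 2 * \<bar>radius u - radius v\<bar>"
      .
    then show ?thesis
      unfolding \<alpha>_def \<beta>_def uv(3,4) \<xi>[OF uv(1)] \<xi>[OF uv(2)] by (simp add: algebra_simps)
  qed
  have in_C: "g c (h * real k) \<in> C" "g (c + (h, 0)) (h * real k) \<in> C" "g (c + (0, h)) (h * real k) \<in> C" "g (c + (h, h)) (h * real k) \<in> C"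
    if "k < K" for k
    using grid_in_column[OF K that] agree unfolding C_def by metis+
  have count: "\<bar>real (card {k. k < K \<and> radius (g c1 (h * real k)) \<le> t}) - real (card {k. k < K \<and> radius (g c2 (h * real k)) \<le> t})\<bar> \<le> 1"
    if "d_inf c1 c2 \<le> h" for c1 c2 t
    using radius_count_le[OF K that, of t] radius_count_le[OF K, of c2 c1 t] that d_inf_commute[of c1 c2] by simp
  have "flux K h c = (\<Sum>k<K. \<alpha> (radius (g (c + (h, h)) (h * real k))) - \<alpha> (radius (g c (h * real k)))
      + (\<beta> (radius (g (c + (h, 0)) (h * real k))) - \<beta> (radius (g (c + (0, h)) (h * real k)))))"
    unfolding flux_def using in_C by (intro sum.cong) (simp_all add: \<alpha>_def \<beta>_def \<xi> X_def Y_def)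
  also have "\<dots> \<le> 2 * (Max (radius ` C) - Min (radius ` C))"
    using C_fin C_ne in_C h
    by (intro chain_variation lip) (auto intro!: count simp: d_inf_def)
  also have "\<dots> \<le> 2 * L"
  proof -
    have "u \<in> C \<Longrightarrow> radius u \<le> L" for u
      using radius_le[of _ c] by (auto simp: C_def column_def)
    then have "Max (radius ` C) \<le> L" using C_fin C_ne by simp
    moreover have "0 \<le> Min (radius ` C)" using C_fin C_ne by (simp add: radius_nonneg)
    ultimately show ?thesis by simp
  qed
  finally show ?thesis .
qed

lemma telescope_two_steps:
  fixes f b :: "nat \<Rightarrow> real"
  assumes "0 \<le> b 0" "\<And>k. Suc k < K \<Longrightarrow> f k \<le> b (Suc k)" "\<And>k. k \<le> K \<Longrightarrow> 0 \<le> f k"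
  shows "(\<Sum>k<K. f (Suc k) - b k) \<le> f K + f (K - 1)"
  using assms
proof (induction K)
  case (Suc K)
  show ?case
  proof (cases K)
    case 0
    then show ?thesis using Suc.prems(1) Suc.prems(3)[of 0] by simp
  next
    case (Suc j)
    have "(\<Sum>k<K. f (Suc k) - b k) \<le> f K + f (K - 1)"
      using Suc.prems Suc.IH by simp
    then show ?thesis using Suc Suc.prems(2)[of j] by simp
  qed
qed simp

text \<open>The column over a corner of the cell lies between the columns over \<open>c\<close> shifted up and down by one
  level. The centres differ by no more than the radii, whose differences telescope.\<close>
lemma flux_le:
  assumes K: "0 < K" "h = m / real K"
  shows "flux K h c \<le> 16 * L"
proof -
  have h: "0 < h" using K m_pos by simp
  have close: "(\<Sum>k<K. radius (g c (h * real (Suc k))) - radius (g c' (h * real k))) \<le> 2 * L" if d: "d_inf c c' \<le> h" for c'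
  proof -
    have "(\<Sum>k<K. radius (g c (h * real (Suc k))) - radius (g c' (h * real k))) \<le> radius (g c (h * real K)) + radius (g c (h * real (K - 1)))"
    proof (rule telescope_two_steps)
      fix k assume k: "Suc k < K"
      have "g c' (h * real (Suc k)) \<le> g c (h * real k)"
        using grid_bounds[OF K, of "Suc k"] grid_bounds[OF K, of k] k d d_inf_commute[of c c']
        by (intro g_mono) (auto simp: algebra_simps)
      then show "radius (g c (h * real k)) \<le> radius (g c' (h * real (Suc k)))" by (rule le_imp_radius_ge)
    qed (simp_all add: radius_nonneg)
    also have "\<dots> \<le> L + L" using grid_bounds[OF K, of K] grid_bounds[OF K, of "K - 1"] by (intro add_mono radius_le) auto
    finally show ?thesis by simp
  qed
  have step: "g c (h * real (Suc k)) \<le> g c' (h * real k)" if d: "d_inf c c' \<le> h" and "k < K" for c' k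
    using grid_bounds[OF K, of "Suc k"] grid_bounds[OF K, of k] that
    by (intro g_mono) (auto simp: algebra_simps)
  have diff: "(\<Sum>k<K. X c1 (h * real k) - X c2 (h * real k)) \<le> 4 * L" "(\<Sum>k<K. Y c1 (h * real k) - Y c2 (h * real k)) \<le> 4 * L"
    if d: "d_inf c c1 \<le> h" "d_inf c c2 \<le> h" for c1 c2
  proof -
    let ?D = "\<lambda>k. (radius (g c (h * real (Suc k))) - radius (g c1 (h * real k))) + (radius (g c (h * real (Suc k))) - radius (g c2 (h * real k)))"
    have "X c1 (h * real k) - X c2 (h * real k) \<le> ?D k" "Y c1 (h * real k) - Y c2 (h * real k) \<le> ?D k" if "k < K" for k
      using step[OF d(1) that] step[OF d(2) that] unfolding X_def Y_def less_eq_sq_def d_inf_def max.bounded_iff by linarith+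
    then have "(\<Sum>k<K. X c1 (h * real k) - X c2 (h * real k)) \<le> sum ?D {..<K}" "(\<Sum>k<K. Y c1 (h * real k) - Y c2 (h * real k)) \<le> sum ?D {..<K}"
      by (auto intro!: sum_mono)
    moreover have "sum ?D {..<K} \<le> 4 * L"
      using close[OF d(1)] close[OF d(2)] unfolding sum.distrib by linarith
    ultimately show "(\<Sum>k<K. X c1 (h * real k) - X c2 (h * real k)) \<le> 4 * L" "(\<Sum>k<K. Y c1 (h * real k) - Y c2 (h * real k)) \<le> 4 * L" by linarith+
  qed
  have near: "d_inf c c \<le> h" "d_inf c (c + (h, 0)) \<le> h" "d_inf c (c + (0, h)) \<le> h" "d_inf c (c + (h, h)) \<le> h"
    using h by (simp_all add: d_inf_def)
  show ?thesis
    using diff(1)[OF near(4,3)] diff(1)[OF near(2,1)] diff(2)[OF near(4,2)] diff(2)[OF near(3,1)]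
    unfolding flux_def sum.distrib by linarith
qed

section \<open>Columns rarely differ from their neighbours\<close>

text \<open>The value at a slightly larger radius is the same by \<open>g_right\<close>, and the larger square contains all
  squares of radius \<open>r\<close> with nearby centres.\<close>
lemma open_above:
  assumes r: "0 \<le> r" "r < m"
  shows "open {c. v \<le> g c r}"
  unfolding open_dist
proof safe
  fix a b assume v: "v \<le> g (a, b) r"
  obtain \<delta> where \<delta>: "0 < \<delta>" "r + \<delta> \<le> m" "g (a, b) (r + \<delta>) = g (a, b) r"
    using g_right[OF r] by blast
  have "v \<le> g c r" if "dist c (a, b) < \<delta>" for c
  proof -
    have "dist (fst c) a \<le> dist c (a, b)" "dist (snd c) b \<le> dist c (a, b)"
      using dist_fst_le[of c "(a, b)"] dist_snd_le[of c "(a, b)"] by simp_all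
    with that have "d_inf (a, b) c \<le> r + \<delta> - r"
      by (simp add: d_inf_def dist_real_def abs_minus_commute)
    then have "g (a, b) (r + \<delta>) \<le> g c r" using r \<delta> by (intro g_mono) auto
    with v \<delta>(3) show ?thesis by simp
  qed
  then show "\<exists>\<epsilon>>0. \<forall>y. dist y (a, b) < \<epsilon> \<longrightarrow> y \<in> {c. v \<le> g c r}" using \<delta>(1) by auto
qed

lemma level_borel:
  assumes r: "0 \<le> r" "r < m"
  shows "{c. g c r = v} \<in> sets borel"
proof -
  \<comment> \<open>Open conditions suffice to locate the value, as only finitely many values lie above \<open>v\<close>.\<close>
  have "{c. g c r = v} = {c. v \<le> g c r} - (\<Union>w\<in>{w \<in> vals. v < w}. {c. w \<le> g c r})"
  proof (intro equalityI subsetI)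
    fix c assume c: "c \<in> {c. v \<le> g c r} - (\<Union>w\<in>{w \<in> vals. v < w}. {c. w \<le> g c r})"
    have "g c r \<in> vals" by (auto simp: vals_def)
    with c show "c \<in> {c. g c r = v}" by (auto simp: order.order_iff_strict)
  qed (auto simp: less_le_not_le)
  moreover have "finite {w \<in> vals. v < w}" using finite_values by (simp add: vals_def)
  ultimately show ?thesis using open_above[OF r] by (auto intro!: sets.Diff sets.finite_UN)
qed

lemma g_measurable:
  fixes f :: "sq \<Rightarrow> real"
  assumes r: "0 \<le> r" "r < m"
  shows "(\<lambda>c. f (g c r)) \<in> borel_measurable borel"
proof -
  have "(\<lambda>c. g c r) \<in> borel \<rightarrow>\<^sub>M count_space vals"
    using finite_values level_borel[OF r]
    by (auto simp: vals_def measurable_count_space_eq2 vimage_def)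
  moreover have "f \<in> borel_measurable (count_space vals)" by simp
  ultimately show ?thesis by (rule measurable_compose)
qed

lemma column_borel: "{c. v \<in> column c} \<in> sets borel"
proof -
  have "{c. v \<in> column c} = (\<Union>q\<in>\<rat> \<inter> {0..<m}. {c. g c q = v})"
  proof (intro equalityI subsetI)
    fix c assume "c \<in> {c. v \<in> column c}"
    then obtain r where r: "0 \<le> r" "r < m" "v = g c r" by (auto simp: column_def)
    obtain \<delta> where \<delta>: "0 < \<delta>" "r + \<delta> \<le> m" "g c (r + \<delta>) = g c r" using g_right[OF r(1,2)] by blast
    obtain q where q: "q \<in> \<rat>" "r < q" "q < r + \<delta>" using Rats_dense_in_real[of r "r + \<delta>"] \<delta>(1) by auto
    have "g c q \<le> g c r" "g c (r + \<delta>) \<le> g c q"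
      using r q \<delta>(1,2) by (auto intro!: g_mono simp: d_inf_def)
    then have "g c q = v" using \<delta>(3) r(3) by simp
    moreover have "q \<in> \<rat> \<inter> {0..<m}" using q r \<delta> by simp
    ultimately show "c \<in> (\<Union>q\<in>\<rat> \<inter> {0..<m}. {c. g c q = v})" by blast
  qed (auto simp: column_def)
  moreover have "countable (\<rat> \<inter> {0..<m})" by (simp add: countable_rat countable_Int1)
  ultimately show ?thesis by (auto intro!: sets.countable_UN' level_borel)
qed

definition irregular :: "real \<Rightarrow> (real \<times> real) set" where
  "irregular h = {c \<in> unit_square. \<exists>a\<in>{(h, 0), (0, h), (h, h)}. column (c + a) \<noteq> column c}"

text \<open>Columns are subsets of the finite set \<open>vals\<close>, so two of them differ only if some \<open>v\<close> in \<open>vals\<close>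
  belongs to exactly one of them. This is a condition on the Borel set of centres whose column contains
  \<open>v\<close>, to which \<open>translation_almost_invariant\<close> applies.\<close>
lemma irregular_small:
  assumes \<eta>: "0 < \<eta>"
  shows "\<exists>h0>0. \<forall>h. 0 < h \<and> h < h0 \<longrightarrow> irregular h \<in> sets borel \<and>
    measure lborel (irregular h) \<le> \<eta>"
proof -
  define \<eta>' where "\<eta>' = \<eta> / (3 * card vals + 1)"
  have \<eta>': "0 < \<eta>'" "3 * card vals * \<eta>' \<le> \<eta>" using \<eta> by (simp_all add: \<eta>'_def field_simps)
  have fv: "finite vals" using finite_values by (simp add: vals_def)
  define E where "E v = {c. v \<in> column c}" for v
  have Eb[measurable]: "E v \<in> sets borel" for v unfolding E_def by (rule column_borel)
  define B where "B v a = {c \<in> unit_square. (c \<in> E v) \<noteq> (c + a \<in> E v)}" for v and a :: "real \<times> real"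
  have "\<exists>d>0. \<forall>a. norm a < d \<longrightarrow> measure lborel (B v a) \<le> \<eta>'" for v
    unfolding B_def by (rule translation_almost_invariant[OF Eb compact_unit_square \<eta>'(1)])
  then obtain d where d: "\<And>v. 0 < d v" "\<And>v a. norm a < d v \<Longrightarrow> measure lborel (B v a) \<le> \<eta>'" by metis
  \<comment> \<open>The factor 2 accounts for the diagonal shift \<open>(h, h)\<close>, whose norm is at most \<open>2 h\<close>.\<close>
  define h0 where "h0 = Min (insert 1 (d ` vals)) / 2"
  have h0: "0 < h0" "\<And>v. v \<in> vals \<Longrightarrow> 2 * h0 \<le> d v" using fv d(1) by (auto simp: h0_def)
  have "irregular h \<in> sets borel \<and> measure lborel (irregular h) \<le> \<eta>"
    if h: "0 < h" "h < h0" for h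
  proof -
    define A where "A = {(h, 0), (0, h), (h, h)}"
    have A: "finite A" "card A = 3" using h by (simp_all add: A_def)
    have A_small: "norm a < 2 * h0" if "a \<in> A" for a
    proof -
      have "norm a \<le> norm (fst a) + norm (snd a)" using norm_Pair_le[of "fst a" "snd a"] by simp
      with that h show ?thesis by (auto simp: A_def)
    qed
    have Bb: "B v a \<in> sets lborel" for v a
    proof -
      have "(\<lambda>c. c + a) -` E v \<in> sets borel" using measurable_sets[of "\<lambda>c. c + a" borel borel "E v"] by simp
      moreover have "B v a = unit_square \<inter> ((E v - (\<lambda>c. c + a) -` E v) \<union> ((\<lambda>c. c + a) -` E v - E v))"
        by (auto simp: B_def)
      ultimately have "B v a \<in> sets borel"
        using Eb unit_square_borel by (metis sets.Int sets.Un sets.Diff)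
      then show ?thesis unfolding sets_lborel .
    qed
    have eq: "irregular h = (\<Union>(v, a)\<in>vals \<times> A. B v a)"
    proof (intro equalityI subsetI)
      fix c assume c: "c \<in> irregular h"
      then obtain a where a: "a \<in> A" "column (c + a) \<noteq> column c" unfolding A_def irregular_def by blast
      then obtain v where v: "(v \<in> column c) \<noteq> (v \<in> column (c + a))" by blast
      then have "v \<in> vals" by (auto simp: column_def vals_def)
      moreover have "c \<in> B v a" using c v by (simp add: B_def E_def irregular_def)
      ultimately show "c \<in> (\<Union>(v, a)\<in>vals \<times> A. B v a)" using a(1) by blast
    next
      fix c assume "c \<in> (\<Union>(v, a)\<in>vals \<times> A. B v a)"
      then obtain v a where "a \<in> A" "c \<in> B v a" by blast
      then show "c \<in> irregular h" unfolding irregular_def B_def E_def A_def by blast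
    qed
    have "(\<Union>(v, a)\<in>vals \<times> A. B v a) \<in> sets lborel" using Bb fv A by auto
    then have meas: "irregular h \<in> sets borel" by (simp add: eq)
    have "measure lborel (irregular h) = measure lborel (\<Union>(v, a)\<in>vals \<times> A. B v a)" by (simp only: eq)
    also have "\<dots> \<le> (\<Sum>(v, a)\<in>vals \<times> A. measure lborel (B v a))"
      using Bb fv A measure_UNION_le[of "vals \<times> A" "\<lambda>(v, a). B v a" lborel] by (auto simp: case_prod_unfold)
    also have "\<dots> \<le> (\<Sum>(v, a)\<in>vals \<times> A. \<eta>')"
      using A_small h0 d by (intro sum_mono) (force simp: less_le_trans)
    also have "\<dots> = 3 * card vals * \<eta>'" using A by (simp add: card_cartesian_product)
    finally show ?thesis using \<eta>'(2) meas by simp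
  qed
  then show ?thesis using h0(1) by blast
qed

section \<open>The flux inequality\<close>

lemma X_shift_integral:
  assumes r: "0 \<le> r" "r < m" and h: "0 < h" "h \<le> 1"
  shows "h * (1 - h - 2 * e) \<le> (LINT c|lborel. indicator unit_square c * (X (c + (h, b)) r - X (c + (0, b)) r))"
    and "integrable lborel (\<lambda>c. indicator unit_square c * (X (c + (h, b)) r - X (c + (0, b)) r))"
proof -
  have meas: "(\<lambda>c. X c r) \<in> borel_measurable borel" unfolding X_def by (rule g_measurable[OF r])
  have bdd: "\<bar>X c r\<bar> \<le> 1" for c
    using center_mem[of "g c r"] by (auto simp: X_def mem_Times_iff)
  have near': "\<bar>X c r - max 0 (min 1 (fst c))\<bar> \<le> e" for c
    using near[of r c] r by (simp add: X_def d_inf_def clamp_def)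
  have gained: "(+) (h, b) ` unit_square - (+) (0, b) ` unit_square = {1<..h + 1} \<times> {b..b + (1::real)}" "measure lborel ({1<..h + 1} \<times> {b..b + (1::real)}) = h"
    and lost: "(+) (0, b) ` unit_square - (+) (h, b) ` unit_square = {0..<h} \<times> {b..b + (1::real)}" "measure lborel ({0..<h} \<times> {b..b + (1::real)}) = h"
    unfolding translate_unit_square using h by (auto intro!: translates_diff simp: measure_lborel_Times)
  have inside: "1 \<le> fst c" if "c \<in> {1<..h + 1} \<times> {b..b + (1::real)}" for c using that by (simp add: mem_Times_iff)
  have outside: "fst c \<le> h" if "c \<in> {0..<h} \<times> {b..b + (1::real)}" for c using that by (simp add: mem_Times_iff)
  note * = near_coordinate_shift_integral[OF meas bdd near' gained inside lost outside less_imp_le[OF h(1)]]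
  show "h * (1 - h - 2 * e) \<le> (LINT c|lborel. indicator unit_square c * (X (c + (h, b)) r - X (c + (0, b)) r))"
    by (rule *(1))
  show "integrable lborel (\<lambda>c. indicator unit_square c * (X (c + (h, b)) r - X (c + (0, b)) r))"
    using *(2) .
qed

lemma Y_shift_integral:
  assumes r: "0 \<le> r" "r < m" and h: "0 < h" "h \<le> 1"
  shows "h * (1 - h - 2 * e) \<le> (LINT c|lborel. indicator unit_square c * (Y (c + (b, h)) r - Y (c + (b, 0)) r))"
    and "integrable lborel (\<lambda>c. indicator unit_square c * (Y (c + (b, h)) r - Y (c + (b, 0)) r))"
proof -
  have meas: "(\<lambda>c. Y c r) \<in> borel_measurable borel" unfolding Y_def by (rule g_measurable[OF r])
  have bdd: "\<bar>Y c r\<bar> \<le> 1" for c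
    using center_mem[of "g c r"] by (auto simp: Y_def mem_Times_iff)
  have near': "\<bar>Y c r - max 0 (min 1 (snd c))\<bar> \<le> e" for c
    using near[of r c] r by (simp add: Y_def d_inf_def clamp_def)
  have gained: "(+) (b, h) ` unit_square - (+) (b, 0) ` unit_square = {b..b + (1::real)} \<times> {1<..h + 1}" "measure lborel ({b..b + (1::real)} \<times> {1<..h + 1}) = h"
    and lost: "(+) (b, 0) ` unit_square - (+) (b, h) ` unit_square = {b..b + (1::real)} \<times> {0..<h}" "measure lborel ({b..b + (1::real)} \<times> {0..<h}) = h"
    unfolding translate_unit_square using h by (auto intro!: translates_diff simp: measure_lborel_Times)
  have inside: "1 \<le> snd c" if "c \<in> {b..b + (1::real)} \<times> {1<..h + 1}" for c using that by (simp add: mem_Times_iff)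
  have outside: "snd c \<le> h" if "c \<in> {b..b + (1::real)} \<times> {0..<h}" for c using that by (simp add: mem_Times_iff)
  note * = near_coordinate_shift_integral[OF meas bdd near' gained inside lost outside less_imp_le[OF h(1)]]
  show "h * (1 - h - 2 * e) \<le> (LINT c|lborel. indicator unit_square c * (Y (c + (b, h)) r - Y (c + (b, 0)) r))"
    by (rule *(1))
  show "integrable lborel (\<lambda>c. indicator unit_square c * (Y (c + (b, h)) r - Y (c + (b, 0)) r))"
    using *(2) .
qed

text \<open>Each of the \<open>4 K\<close> differences contributes at least \<open>h (1 - h - 2 e)\<close>, and \<open>K h = m\<close>.\<close>
lemma flux_integral:
  assumes K: "0 < K" "h = m / real K" and h: "h \<le> 1"
  shows "4 * m * (1 - h - 2 * e) \<le> (LINT c|lborel. indicator unit_square c * flux K h c)"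
    and "integrable lborel (\<lambda>c. indicator unit_square c * flux K h c)"
proof -
  have h0: "0 < h" "real K * h = m" using K m_pos by simp_all
  define q where "q k c = indicator unit_square c * (X (c + (h, h)) (h * real k) - X (c + (0, h)) (h * real k))
      + indicator unit_square c * (X (c + (h, 0)) (h * real k) - X (c + (0, 0)) (h * real k))
      + (indicator unit_square c * (Y (c + (h, h)) (h * real k) - Y (c + (h, 0)) (h * real k))
      + indicator unit_square c * (Y (c + (0, h)) (h * real k) - Y (c + (0, 0)) (h * real k)))" for k c
  have eq: "indicator unit_square c * flux K h c = (\<Sum>k<K. q k c)" for c
    unfolding flux_def sum_distrib_left q_def by (intro sum.cong) (simp_all add: algebra_simps zero_prod_def[symmetric])
  have k: "0 \<le> h * real k" "h * real k < m" if "k < K" for k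
  proof -
    show "0 \<le> h * real k" using h0 by simp
    have "h * real k < h * real K" using h0 that by simp
    then show "h * real k < m" using h0(2) by (simp add: mult.commute)
  qed
  have int: "integrable lborel (q k)" and ge: "4 * (h * (1 - h - 2 * e)) \<le> (LINT c|lborel. q k c)" if "k < K" for k
  proof -
    note XY = X_shift_integral[OF k[OF that] h0(1) h] Y_shift_integral[OF k[OF that] h0(1) h]
    show "integrable lborel (q k)"
      unfolding q_def using XY by (intro Bochner_Integration.integrable_add) auto
    have "(LINT c|lborel. q k c) = (LINT c|lborel. indicator unit_square c * (X (c + (h, h)) (h * real k) - X (c + (0, h)) (h * real k)))
      + (LINT c|lborel. indicator unit_square c * (X (c + (h, 0)) (h * real k) - X (c + (0, 0)) (h * real k)))
      + ((LINT c|lborel. indicator unit_square c * (Y (c + (h, h)) (h * real k) - Y (c + (h, 0)) (h * real k)))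
      + (LINT c|lborel. indicator unit_square c * (Y (c + (0, h)) (h * real k) - Y (c + (0, 0)) (h * real k))))"
      unfolding q_def using XY(2,4) by (simp only: Bochner_Integration.integral_add Bochner_Integration.integrable_add)
    then show "4 * (h * (1 - h - 2 * e)) \<le> (LINT c|lborel. q k c)"
      using XY(1)[of h] XY(1)[of 0] XY(3)[of h] XY(3)[of 0] by linarith
  qed
  show "integrable lborel (\<lambda>c. indicator unit_square c * flux K h c)"
    unfolding eq using int by auto
  have "4 * m * (1 - h - 2 * e) = (\<Sum>k<K. 4 * (h * (1 - h - 2 * e)))"
    by (simp add: h0(2)[symmetric])
  also have "\<dots> \<le> (\<Sum>k<K. LINT c|lborel. q k c)" using ge by (intro sum_mono) auto
  also have "\<dots> = (LINT c|lborel. indicator unit_square c * flux K h c)"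
    unfolding eq using int by (subst Bochner_Integration.integral_sum) auto
  finally show "4 * m * (1 - h - 2 * e) \<le> (LINT c|lborel. indicator unit_square c * flux K h c)" .
qed

text \<open>As \<open>h\<close> tends to 0, the integral of the flux over the unit square is at least
  \<open>4 m (1 - 2 e)\<close> in the limit and at most \<open>2 L\<close>, since the irregular cells, on which the bound is \<open>16 L\<close>, have
  vanishing area.\<close>
theorem flux_inequality: "2 * m * (1 - 2 * e) \<le> L"
proof (rule ccontr)
  assume "\<not> 2 * m * (1 - 2 * e) \<le> L"
  \<comment> \<open>The errors of the two estimates, \<open>4 m h\<close> and \<open>16 L\<close> times the irregular area, are each made at most a quarter of this gap.\<close>
  define \<gamma> where "\<gamma> = 4 * m * (1 - 2 * e) - 2 * L"
  have \<gamma>: "0 < \<gamma>" using \<open>\<not> _\<close> by (simp add: \<gamma>_def algebra_simps)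
  have L: "0 \<le> L" using radius_le[of 0 "(0, 0)"] radius_nonneg[of "g (0, 0) 0"] m_pos by linarith
  define \<eta> where "\<eta> = \<gamma> / (4 * (16 * L + 1))"
  have \<eta>: "0 < \<eta>" "16 * L * \<eta> \<le> \<gamma> / 4" using \<gamma> L by (simp_all add: \<eta>_def field_simps)
  obtain h0 where h0: "0 < h0" "\<And>h. 0 < h \<Longrightarrow> h < h0 \<Longrightarrow> irregular h \<in> sets borel \<and> measure lborel (irregular h) \<le> \<eta>"
    using irregular_small[OF \<eta>(1)] by blast
  obtain K :: nat where K0: "m / min (min h0 1) (\<gamma> / (16 * m)) < real K" using reals_Archimedean2 by blast
  define t where "t = min (min h0 1) (\<gamma> / (16 * m))"
  have t: "0 < t" "t \<le> h0" "t \<le> 1" "t \<le> \<gamma> / (16 * m)" using h0(1) \<gamma> m_pos by (auto simp: t_def)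
  have Kpos: "0 < K"
  proof -
    have "0 < m / t" using t m_pos by simp
    with K0 show ?thesis unfolding t_def[symmetric] by (simp add: order.strict_trans)
  qed
  define h where "h = m / real K"
  have h: "0 < h" "h < t" using K0 Kpos t(1) m_pos unfolding t_def[symmetric] h_def by (simp_all add: field_simps)
  have h1: "4 * m * h \<le> \<gamma> / 4"
  proof -
    have "h \<le> \<gamma> / (16 * m)" using h t by linarith
    then show ?thesis using m_pos by (simp add: field_simps)
  qed
  have irr: "irregular h \<in> sets borel" "measure lborel (irregular h) \<le> \<eta>" using h0(2)[of h] h t by auto
  note Q = unit_square_borel unit_square_finite
  have Q1: "measure lborel unit_square = 1" by (simp add: measure_lborel_Times)
  have "emeasure lborel (irregular h) \<le> emeasure lborel unit_square"
    using Q by (intro emeasure_mono) (auto simp: irregular_def)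
  then have irr_fin: "emeasure lborel (irregular h) < \<infinity>" using Q(2) by (rule le_less_trans)
  have "4 * m * (1 - h - 2 * e) \<le> (LINT c|lborel. indicator unit_square c * flux K h c)"
    using flux_integral(1)[OF Kpos h_def] h t by simp
  also have "\<dots> \<le> (LINT c|lborel. 2 * L * indicator unit_square c + 16 * L * indicator (irregular h) c)"
  proof (rule integral_mono)
    show "integrable lborel (\<lambda>c. indicator unit_square c * flux K h c)"
      using flux_integral(2)[OF Kpos h_def] h t by simp
    show "integrable lborel (\<lambda>c. 2 * L * indicator unit_square c + 16 * L * indicator (irregular h) c)"
      using Q irr irr_fin by auto
    fix c
    show "indicator unit_square c * flux K h c \<le> 2 * L * indicator unit_square c + 16 * L * indicator (irregular h) c"
    proof (cases "c \<in> unit_square")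
      case True
      then show ?thesis
      proof (cases "c \<in> irregular h")
        case True
        then show ?thesis using flux_le[OF Kpos h_def, of c] L by (auto simp: irregular_def)
      next
        case False
        with \<open>c \<in> unit_square\<close> have "column (c + a) = column c" if "a \<in> {(h, 0), (0, h), (h, h)}" for a
          using that by (auto simp: irregular_def)
        then have "flux K h c \<le> 2 * L" by (intro flux_le_if_columns_agree[OF Kpos h_def]) auto
        then show ?thesis using False \<open>c \<in> unit_square\<close> by simp
      qed
    qed (use L in \<open>simp add: irregular_def\<close>)
  qed
  also have "\<dots> = 2 * L + 16 * L * measure lborel (irregular h)"
    using Q Q1 irr irr_fin by (subst Bochner_Integration.integral_add) auto
  also have "\<dots> \<le> 2 * L + \<gamma> / 4"
    using irr(2) L \<eta>(2) mult_left_mono[of "measure lborel (irregular h)" \<eta> "16 * L"] by linarith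
  also have "4 * m * (1 - h - 2 * e) = \<gamma> + 2 * L - 4 * m * h" by (simp add: \<gamma>_def algebra_simps)
  finally show False using h1 \<gamma> by linarith
qed

end

section \<open>Deflations\<close>

text \<open>The square is the supremum of the larger concentric squares. Scott-continuity makes its image the
  supremum of their images, which form a finite chain, so the supremum is attained.\<close>
lemma deflation_constant_near:
  assumes \<sigma>: "deflation \<sigma>" and c: "c \<in> {0..1} \<times> {0..1}" and r: "0 \<le> r"
  shows "\<exists>\<delta>>0. \<forall>s. r \<le> s \<and> s \<le> r + \<delta> \<longrightarrow> \<sigma> (Some (Sq (c, s))) = \<sigma> (Some (Sq (c, r)))"
proof -
  let ?p = "\<lambda>s. Some (Sq (c, s))"
  have le: "?p s \<le> ?p t" if "0 \<le> t" "t \<le> s" for s t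
    using that c by (simp add: less_eq_sq_def center_Sq radius_Sq d_inf_def)
  define A where "A = ?p ` {r<..}"
  have "directed A"
    unfolding directed_def
  proof (intro allI impI)
    fix F assume "finite F \<and> F \<subseteq> A"
    then obtain T where T: "finite T" "T \<subseteq> {r<..}" "F = ?p ` T"
      unfolding A_def by (meson finite_subset_image)
    have mT: "r < Min (insert (r + 1) T)" using T by auto
    have "\<forall>x\<in>F. x \<le> ?p (Min (insert (r + 1) T))"
    proof
      fix x assume "x \<in> F"
      then obtain s where s: "s \<in> T" "x = ?p s" using T(3) by blast
      have "Min (insert (r + 1) T) \<le> s" using T(1) s(1) by (intro Min_le) auto
      with mT r show "x \<le> ?p (Min (insert (r + 1) T))" unfolding s(2) by (intro le) linarith+
    qed
    with mT show "\<exists>u\<in>A. \<forall>x\<in>F. x \<le> u" unfolding A_def by blast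
  qed
  moreover have "isLub UNIV A (?p r)"
  proof -
    have "?p r \<le> u" if u: "\<And>s. r < s \<Longrightarrow> ?p s \<le> u" for u
    proof -
      obtain v where v: "u = Some v" using u[of "r + 1"] by (cases u) auto
      have "d_inf c (center v) + radius v \<le> s" if "r < s" for s
        using u[OF that] that r c by (simp add: v less_eq_sq_def center_Sq radius_Sq)
      then have "d_inf c (center v) + radius v \<le> r" by (rule dense_ge)
      then show ?thesis using r c by (simp add: v less_eq_sq_def center_Sq radius_Sq)
    qed
    then show ?thesis
      using le r by (auto simp: isLub_def isUb_def leastP_def setle_def setge_def A_def)
  qed
  ultimately have lub: "isLub UNIV (\<sigma> ` A) (\<sigma> (?p r))"
    using \<sigma> unfolding deflation_def scott_continuous_def by blast
  have mono: "mono \<sigma>" and fin: "finite (\<sigma> ` A)"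
    using \<sigma> finite_subset[OF image_mono[OF subset_UNIV], of \<sigma> A]
    unfolding deflation_def scott_continuous_def by auto
  obtain T where T: "finite T" "T \<subseteq> {r<..}" "\<sigma> ` A = \<sigma> ` ?p ` T"
  proof -
    have "\<sigma> ` A = (\<lambda>s. \<sigma> (?p s)) ` {r<..}" unfolding A_def by (simp add: image_image)
    with fin obtain T where "finite T" "T \<subseteq> {r<..}" "\<sigma> ` A = (\<lambda>s. \<sigma> (?p s)) ` T"
      by (metis finite_subset_image order_refl)
    then show ?thesis using that by (simp add: image_image)
  qed
  \<comment> \<open>Finitely many radii realise all values at radii above \<open>r\<close>; the smallest of them gives an upper bound of the image. The entry \<open>r + 1\<close> only ensures that the minimum is taken over a nonempty set.\<close>
  define t where "t = Min (insert (r + 1) T)"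
  have t: "r < t" "\<And>s. s \<in> T \<Longrightarrow> t \<le> s" using T by (auto simp: t_def)
  have "isUb UNIV (\<sigma> ` A) (\<sigma> (?p t))"
    unfolding T(3) isUb_def setle_def using t r by (auto intro!: monoD[OF mono] le)
  then have up: "\<sigma> (?p r) \<le> \<sigma> (?p t)"
    using lub by (auto simp: isLub_def leastP_def setge_def)
  have "\<sigma> (?p s) = \<sigma> (?p r)" if "r \<le> s" "s \<le> t" for s
  proof -
    have "\<sigma> (?p r) \<le> \<sigma> (?p s)"
      using up monoD[OF mono le[of s t]] that r by (meson order.trans)
    moreover have "\<sigma> (?p s) \<le> \<sigma> (?p r)"
      using monoD[OF mono le[of r s]] that r by blast
    ultimately show ?thesis by (rule order.antisym[rotated])
  qed
  moreover have "r + (t - r) = t" "0 < t - r" using t(1) by simp_all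
  ultimately show ?thesis by metis
qed

theorem corollary5p9:
  fixes \<sigma> :: "sq option \<Rightarrow> sq option" and m :: real
  assumes "deflation \<sigma>" and "0 \<le> m"
  shows "\<exists>c \<in> {0..1} \<times> {0..1}. \<exists>r \<in> {0..m}.
           R (\<sigma> (Some (Sq (c, r)))) - ereal r \<ge> ereal (m / (4 * m + 1))"
proof (rule ccontr)
  let ?e = "m / (4 * m + 1)"
  assume neg: "\<not> ?thesis"
  have mono: "mono \<sigma>" and fin: "finite (range \<sigma>)" and below: "\<And>x. \<sigma> x \<le> x"
    using assms(1) unfolding deflation_def scott_continuous_def by auto
  define g where "g c r = the (\<sigma> (Some (Sq (clamp c, r))))" for c r
  have g: "\<sigma> (Some (Sq (clamp c, r))) = Some (g c r)" "radius (g c r) < r + ?e"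
    "d_inf (center (g c r)) (clamp c) \<le> radius (g c r) - r" if "0 \<le> r" "r \<le> m" for c r
  proof -
    have lt: "R (\<sigma> (Some (Sq (clamp c, r)))) - ereal r < ereal ?e"
      using neg clamp_mem[of c] that by force
    then show some: "\<sigma> (Some (Sq (clamp c, r))) = Some (g c r)"
      by (cases "\<sigma> (Some (Sq (clamp c, r)))") (simp_all add: g_def)
    show "radius (g c r) < r + ?e" using lt unfolding some by simp
    show "d_inf (center (g c r)) (clamp c) \<le> radius (g c r) - r"
      using below[of "Some (Sq (clamp c, r))"] that clamp_mem[of c]
      unfolding some by (simp add: less_eq_sq_def center_Sq radius_Sq)
  qed
  \<comment> \<open>For \<open>m = 0\<close> the assumed strict bound contradicts \<open>\<sigma> x \<le> x\<close>.\<close>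
  have "m \<noteq> 0" using g(2,3)[of 0 "(0, 0)"] by (auto simp: d_inf_def)
  then have m: "0 < m" using assms(2) by simp
  have g_mono: "g c r \<le> g c' s" if "0 \<le> s" "r \<le> m" "d_inf c c' \<le> r - s" for c c' r s
  proof -
    have "0 \<le> d_inf c c'" by (simp add: d_inf_def)
    then have sr: "0 \<le> r" "s \<le> m" using that by linarith+
    have "Sq (clamp c, r) \<le> Sq (clamp c', s)"
      using that sr clamp_mem d_inf_clamp_le[of c c'] by (simp add: less_eq_sq_def center_Sq radius_Sq)
    then have "\<sigma> (Some (Sq (clamp c, r))) \<le> \<sigma> (Some (Sq (clamp c', s)))" by (intro monoD[OF mono]) simp
    then show ?thesis using g(1) that sr by simp
  qed
  have rng: "range (\<lambda>(c, r). g c r) \<subseteq> the ` range \<sigma>" by (auto simp: g_def)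
  have g_fin: "finite (range (\<lambda>(c, r). g c r))" using finite_subset[OF rng] fin by blast
  have g_right: "\<exists>\<delta>>0. r + \<delta> \<le> m \<and> g c (r + \<delta>) = g c r" if r: "0 \<le> r" "r < m" for c r
  proof -
    obtain \<delta> where \<delta>: "0 < \<delta>" "\<And>s. r \<le> s \<Longrightarrow> s \<le> r + \<delta> \<Longrightarrow> \<sigma> (Some (Sq (clamp c, s))) = \<sigma> (Some (Sq (clamp c, r)))"
      using deflation_constant_near[OF assms(1) clamp_mem r(1), of c] by blast
    have "g c (r + min \<delta> (m - r)) = g c r"
      unfolding g_def using r \<delta>(1) by (subst \<delta>(2)) simp_all
    then show ?thesis using r \<delta>(1) by (intro exI[of _ "min \<delta> (m - r)"]) simp
  qed
  \<comment> \<open>A maximum over finitely many values, hence still strictly below the bound; the strictness survives the limit in \<open>flux_inequality\<close>.\<close>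
  define L where "L = Max ((\<lambda>c. radius (g c m)) ` UNIV)"
  have fin_m: "finite ((\<lambda>c. radius (g c m)) ` UNIV)"
  proof -
    have "(\<lambda>c. radius (g c m)) ` UNIV \<subseteq> radius ` range (\<lambda>(c, r). g c r)" by auto
    then show ?thesis using g_fin by (meson finite_imageI finite_subset)
  qed
  have "L \<in> (\<lambda>c. radius (g c m)) ` UNIV" unfolding L_def by (rule Max_in[OF fin_m]) simp
  then have L_less: "L < m + ?e" using g(2) m by fastforce
  have L_ge: "radius (g c r) \<le> L" if "0 \<le> r" "r \<le> m" for c r
  proof -
    have "g c m \<le> g c r" using that by (intro g_mono) (auto simp: d_inf_def)
    then have "radius (g c r) \<le> radius (g c m)" unfolding less_eq_sq_def d_inf_def by linarith
    also have "\<dots> \<le> L" unfolding L_def using fin_m by (intro Max_ge) auto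
    finally show ?thesis .
  qed
  interpret step_family g m L ?e
  proof
    show "d_inf (center (g c r)) (clamp c) \<le> ?e" if "0 \<le> r" "r \<le> m" for c r
      using g(2,3)[OF that, of c] by linarith
  qed (fact m g_mono g_fin g_right L_ge)+
  have "2 * m * (1 - 2 * ?e) = m + ?e" using m by (simp add: field_simps)
  then show False using flux_inequality L_less by linarith
qed

end
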